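(* Let $J_n$ be the Jacobsthal numbers, i.e., $J_0=0$, $J_1=1$, and $J_{n+2}=J_{n+1}+2J_n$ for $n\ge 0$. Then for all integers $m\geq 3$ and $n\geq 2$, $$\sum_{j=0}^n F_j^{(m)} F_{n-j}^{(m-2)} = J_{n-1} + \sum_{j=0}^{n-2} J_j \left(F_{n-j}^{(m-2)} - F_{n-2-j}^{(m)} \right).$$
   Context: For each integer $m\ge 1$ the Fibonacci $m$-step numbers $F_n^{(m)}$ are defined by $F_n^{(m)}=0$ for $n=-(m-2),\ldots,0$ (with $F_0^{(1)}=0$ when $m=1$), $F_1^{(m)}=1$, and $F_n^{(m)}=\sum_{j=1}^m F_{n-j}^{(m)}$ for all $n\ge 2$. In particular $F_n^{(1)}=1$ for all $n\ge 1$. *)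

theory Defs
  imports Main
begin

text \<open>
  For \<open>m \<ge> 1\<close>, \<open>fib_step m n\<close> is the Fibonacci \<open>m\<close>-step number with index \<open>n\<close>. The index is an
  integer because the initial values include \<open>n = -(m-2), \<dots>, 0\<close>. The values at \<open>n < -(m-2)\<close>
  (with \<open>n < 0\<close> if \<open>m = 1\<close>) and at \<open>m = 0\<close> are junk; the recurrence for \<open>m \<ge> 1\<close>, \<open>n \<ge> 2\<close> never
  reaches them. The values are integers so that subtraction is not truncated.
\<close>

function fib_step :: "nat \<Rightarrow> int \<Rightarrow> int" where
  "fib_step m n =
    (if n \<le> 0 then 0 else if n = 1 then 1 else (\<Sum>j = 1..m. fib_step m (n - int j)))"
  by pat_completeness auto
termination
  by (relation "measure (\<lambda>(m, n). nat n)") auto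

declare fib_step.simps [simp del]

fun jacobsthal :: "nat \<Rightarrow> int" where
  "jacobsthal 0 = 0"
| "jacobsthal (Suc 0) = 1"
| "jacobsthal (Suc (Suc n)) = jacobsthal (Suc n) + 2 * jacobsthal n"

end

theory Submission
  imports Defs "HOL-Computational_Algebra.Formal_Power_Series"
begin

text \<open>
  Write \<open>A\<close>, \<open>B\<close> and \<open>J\<close> for the generating functions of the \<open>m\<close>-step numbers, the
  \<open>(m - 2)\<close>-step numbers and the Jacobsthal numbers. The recurrences make each of them \<open>X\<close> divided by
  a polynomial:
  \<open>A = X / (1 - X - \<dots> - X\<^sup>m)\<close>, \<open>B = X / (1 - X - \<dots> - X\<^bsup>m-2\<^esup>)\<close>, \<open>J = X / (1 - X - 2 X\<^sup>2)\<close>.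
  The three denominators satisfy
  \<open>(1 - X - \<dots> - X\<^sup>m) - X\<^sup>2 (1 - X - \<dots> - X\<^bsup>m-2\<^esup>) = 1 - X - 2 X\<^sup>2\<close>,
  because all powers from \<open>X\<^sup>3\<close> on cancel. In other words \<open>1/J = 1/A - X\<^sup>2/B\<close>, and clearing
  denominators gives the convolution identity \<open>A B = J B - X\<^sup>2 J A\<close>.

  The theorem is the comparison of the coefficients of \<open>X\<^sup>n\<close>. In \<open>J B\<close> the summands with index
  \<open>j = n - 1\<close> and \<open>j = n\<close> contribute \<open>J\<^bsub>n-1\<^esub>\<close> and \<open>0\<close>, and what is left of the two products on the
  right has the range \<open>j \<le> n - 2\<close>.
\<close>

unbundle fps_syntax

definition fib_step_fps :: "nat \<Rightarrow> int fps" where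
  "fib_step_fps m = Abs_fps (\<lambda>n. fib_step m (int n))"

definition jacobsthal_fps :: "int fps" where
  "jacobsthal_fps = Abs_fps jacobsthal"

lemma fib_step_nonpos: "n \<le> 0 \<Longrightarrow> fib_step m n = 0"
  by (subst fib_step.simps) simp

lemma fib_step_1: "fib_step m 1 = 1"
  by (subst fib_step.simps) simp

lemma fib_step_rec:
  "n \<ge> 2 \<Longrightarrow> fib_step m n = (\<Sum>j = 1..m. fib_step m (n - int j))"
  by (subst fib_step.simps) simp

text \<open>
  The value \<open>0\<close> at all nonpositive indices is what makes a shifted coefficient equal to a
  shifted index without a case distinction, so the recurrence turns into a product.
\<close>

lemma fib_step_fps_denominator:
  "(1 - (\<Sum>j = 1..m. fps_X ^ j)) * fib_step_fps m = fps_X"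
proof (rule fps_ext)
  fix n
  have shift: "(fps_X ^ j * fib_step_fps m) $ n = fib_step m (int n - int j)" for j
    by (simp add: fib_step_fps_def fps_X_power_mult_nth fib_step_nonpos of_nat_diff)
  have "((1 - (\<Sum>j = 1..m. fps_X ^ j)) * fib_step_fps m) $ n =
      fib_step m (int n) - (\<Sum>j = 1..m. fib_step m (int n - int j))"
    by (simp add: left_diff_distrib sum_distrib_right fps_sum_nth shift)
       (simp add: fib_step_fps_def)
  also have "\<dots> = fps_X $ n"
  proof (cases "n \<ge> 2")
    case True
    then show ?thesis by (simp add: fib_step_rec[of "int n"])
  next
    case False
    then have "(\<Sum>j = 1..m. fib_step m (int n - int j)) = 0"
      by (intro sum.neutral) (auto intro: fib_step_nonpos)
    moreover from False have "n = 0 \<or> n = 1" by auto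
    ultimately show ?thesis by (auto simp: fib_step_nonpos fib_step_1)
  qed
  finally show "((1 - (\<Sum>j = 1..m. fps_X ^ j)) * fib_step_fps m) $ n = fps_X $ n" .
qed

lemma jacobsthal_fps_denominator:
  "(1 - fps_X - 2 * fps_X ^ 2) * jacobsthal_fps = fps_X"
proof (rule fps_ext)
  fix n
  have "(1 - fps_X - 2 * fps_X ^ 2) * jacobsthal_fps =
      jacobsthal_fps - fps_X ^ 1 * jacobsthal_fps
        - (fps_X ^ 2 * jacobsthal_fps + fps_X ^ 2 * jacobsthal_fps)"
    by (simp add: algebra_simps)
  then have "((1 - fps_X - 2 * fps_X ^ 2) * jacobsthal_fps) $ n =
      jacobsthal_fps $ n - (fps_X ^ 1 * jacobsthal_fps) $ n
        - 2 * (fps_X ^ 2 * jacobsthal_fps) $ n"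
    by (simp only: fps_sub_nth fps_add_nth mult_2)
  also have "\<dots> = fps_X $ n"
    by (cases n rule: jacobsthal.cases)
       (simp_all add: jacobsthal_fps_def fps_X_power_mult_nth del: power_one_right)
  finally show "((1 - fps_X - 2 * fps_X ^ 2) * jacobsthal_fps) $ n = fps_X $ n" .
qed

lemma denominator_relation:
  fixes x :: "'a :: comm_ring_1"
  shows "(1 - (\<Sum>j = 1..k + 2. x ^ j)) - x ^ 2 * (1 - (\<Sum>j = 1..k. x ^ j)) = 1 - x - 2 * x ^ 2"
  by (induction k) (simp_all add: algebra_simps power2_eq_square)

lemma fib_step_fps_convolution:
  "fib_step_fps (k + 2) * fib_step_fps k =
    jacobsthal_fps * fib_step_fps k - fps_X ^ 2 * (jacobsthal_fps * fib_step_fps (k + 2))"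
proof -
  define A where "A = fib_step_fps (k + 2)"
  define B where "B = fib_step_fps k"
  define J where "J = jacobsthal_fps"
  define P :: "int fps" where "P = 1 - (\<Sum>j = 1..k + 2. fps_X ^ j)"
  define Q :: "int fps" where "Q = 1 - (\<Sum>j = 1..k. fps_X ^ j)"
  have PA: "P * A = fps_X" and QB: "Q * B = fps_X"
    unfolding A_def B_def P_def Q_def by (rule fib_step_fps_denominator)+
  have RJ: "(P - fps_X ^ 2 * Q) * J = fps_X"
    unfolding P_def Q_def J_def denominator_relation by (rule jacobsthal_fps_denominator)
  \<comment> \<open>Multiplying by \<open>X = (P - X\<^sup>2 Q) J\<close> lets each remaining denominator meet its own series.\<close>
  have "fps_X * (A * B) = ((P - fps_X ^ 2 * Q) * J) * (A * B)"
    by (simp only: RJ)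
  also have "\<dots> = (P * A) * (J * B) - fps_X ^ 2 * (Q * B) * (J * A)"
    by (simp add: algebra_simps)
  also have "\<dots> = fps_X * (J * B - fps_X ^ 2 * (J * A))"
    unfolding PA QB by (simp add: algebra_simps)
  finally have "A * B = J * B - fps_X ^ 2 * (J * A)"
    by simp
  then show ?thesis
    by (simp only: A_def B_def J_def)
qed

theorem theorem2p24:
  fixes m n :: nat
  assumes "m \<ge> 3" and "n \<ge> 2"
  shows "(\<Sum>j = 0..n. fib_step m (int j) * fib_step (m - 2) (int n - int j)) =
    jacobsthal (n - 1) +
    (\<Sum>j = 0..n - 2. jacobsthal j *
      (fib_step (m - 2) (int n - int j) - fib_step m (int n - 2 - int j)))"
proof -
  define k where "k = m - 2"
  have m: "m = k + 2" using assms(1) by (simp add: k_def)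
  obtain l where n: "n = Suc (Suc l)"
    using assms(2) by (metis add_2_eq_Suc le_Suc_ex)
  have AB: "(fib_step_fps m * fib_step_fps k) $ n =
      (\<Sum>j = 0..n. fib_step m (int j) * fib_step k (int n - int j))"
    unfolding fps_mult_nth by (intro sum.cong) (simp_all add: fib_step_fps_def of_nat_diff)
  have "(jacobsthal_fps * fib_step_fps k) $ n =
      (\<Sum>j = 0..n. jacobsthal j * fib_step k (int n - int j))"
    unfolding fps_mult_nth
    by (intro sum.cong) (simp_all add: fib_step_fps_def jacobsthal_fps_def of_nat_diff)
  also have "\<dots> = jacobsthal (n - 1) + (\<Sum>j = 0..l. jacobsthal j * fib_step k (int n - int j))"
    by (simp add: n fib_step_nonpos fib_step_1)
  finally have JB: "(jacobsthal_fps * fib_step_fps k) $ n =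
      jacobsthal (n - 1) + (\<Sum>j = 0..l. jacobsthal j * fib_step k (int n - int j))" .
  have "(fps_X ^ 2 * (jacobsthal_fps * fib_step_fps m)) $ n = (jacobsthal_fps * fib_step_fps m) $ l"
    by (simp add: n fps_X_power_mult_nth)
  also have "\<dots> = (\<Sum>j = 0..l. jacobsthal j * fib_step m (int n - 2 - int j))"
    unfolding fps_mult_nth
    by (intro sum.cong) (simp_all add: n fib_step_fps_def jacobsthal_fps_def of_nat_diff)
  finally have JA: "(fps_X ^ 2 * (jacobsthal_fps * fib_step_fps m)) $ n =
      (\<Sum>j = 0..l. jacobsthal j * fib_step m (int n - 2 - int j))" .
  have "(fib_step_fps m * fib_step_fps k) $ n =
      (jacobsthal_fps * fib_step_fps k) $ n
        - (fps_X ^ 2 * (jacobsthal_fps * fib_step_fps m)) $ n"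
    unfolding m fib_step_fps_convolution by simp
  then show ?thesis
    unfolding AB JB JA by (simp add: n k_def right_diff_distrib sum_subtractf)
qed

end
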